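(* Let $m\ge 1$ and let $\mathcal S=\{G_1(y,y')=0,\ G_2(y,y',y'')=0,\ \ldots,\ G_m(y,\ldots,y^{(m)})=0\}$ be a regular chain (for the ordering $y<y'<\cdots<y^{(m)}$) of the form $$G_1=\sum_{j=0}^{r_1}G_{1,j}(y)\,(y')^j,\qquad G_i=\sum_{j=0}^{r_i}G_{i,j}(y,\ldots,y^{(i-1)})\,(y^{(i)})^j\quad(2\le i\le m),$$ with complex polynomial coefficients, $r_i\ge1$ and $G_{i,r_i}\ne0$ for $1\le i\le m$, where $G_1$, viewed as a polynomial in $\mathbb{C}[u_0,u_1]$ via $u_0=y$, $u_1=y'$, is square-free and has no non-constant factor in $\mathbb{C}[u_0]$ or in $\mathbb{C}[u_1]$. Then $\mathcal S$ and its reduced differential equation $H(y,y')=0$ have the same non-constant formal Puiseux series solutions (expanded around a finite point or at infinity).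
   Context: A formal Puiseux series around $x_0\in\mathbb{C}$ is $\sum_{j\ge p}c_j(x-x_0)^{j/n}$ ($p\in\mathbb{Z}$, $n\in\mathbb{Z}_{>0}$, $c_j\in\mathbb{C}$), at infinity $\sum_{j\ge p}c_jx^{-j/n}$, with term-by-term derivation in $x$; it is a solution of a set of differential equations if all of them vanish upon substituting $y(x),y'(x),y''(x),\ldots$ Regular chain. For a non-constant polynomial $f$ in $y<y'<\cdots<y^{(m)}$, its leading variable $\mathrm{lv}(f)$ is the largest variable occurring in it, and its initial $\mathrm{init}(f)$ is its leading coefficient with respect to $\mathrm{lv}(f)$. A triangular system $\{G_1,\ldots,G_m\}$ (i.e. $\mathrm{lv}(G_1)<\cdots<\mathrm{lv}(G_m)$) is a regular chain if for every $f\in\{\mathrm{init}(G_1),\ldots,\mathrm{init}(G_m)\}$ the iterated resultant $\mathrm{Res}_{\mathrm{lv}(G_1)}(\cdots\mathrm{Res}_{\mathrm{lv}(G_m)}(f,G_m)\cdots,G_1)$ is nonzero. Reduced differential equation of $\mathcal S$. Write $u_i$ for $y^{(i)}$. For $j\ge2$ the $(j-1)$-st total derivative of $G_1(y,y')$ has the form $G_1^{(j-1)}=\frac{\partial G_1}{\partial u_1}(y,y')\,y^{(j)}+R_{j-1}(y,\ldots,y^{(j-1)})$. Put $A_j(u_0,\ldots,u_{j-1})=-R_{j-1}(u_0,\ldots,u_{j-1})/\frac{\partial G_1}{\partial u_1}(u_0,u_1)$ for $2\le j\le m$, and recursively $B_2=A_2(u_0,u_1)$, $B_j=A_j(u_0,u_1,B_2,\ldots,B_{j-1})\in\mathbb{C}(u_0,u_1)$.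 Let $H_1=G_1(u_0,u_1)$ and let $H_j\in\mathbb{C}[u_0,u_1]$ be the numerator of the rational function $G_j(u_0,u_1,B_2,\ldots,B_j)$ for $2\le j\le m$. The reduced differential equation of $\mathcal S$ is $H(y,y')=0$ with $H=\gcd(H_1,\ldots,H_m)$. *)

theory Defs
  imports
    Complex_Main
    "HOL-Library.Poly_Mapping"
    "HOL-Computational_Algebra.Computational_Algebra"
    "HOL-Computational_Algebra.Field_as_Ring"
    "Subresultants.Resultant_Prelim"
begin

section \<open>Differential polynomials\<close>

text \<open>
  A differential polynomial in \<open>y\<close> is a complex polynomial in the indeterminates
  \<open>u\<^sub>0, u\<^sub>1, u\<^sub>2, \<dots>\<close>, where \<open>u\<^sub>i\<close> stands for the \<open>i\<close>-th derivative of \<open>y\<close>. A monomial is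
  the finitely supported map sending an index \<open>i\<close> to the exponent of \<open>u\<^sub>i\<close>.
\<close>

type_synonym dpoly = "(nat \<Rightarrow>\<^sub>0 nat) \<Rightarrow>\<^sub>0 complex"

definition dconst :: "complex \<Rightarrow> dpoly" where
  "dconst c = Poly_Mapping.single 0 c"

definition dvar :: "nat \<Rightarrow> dpoly" where
  "dvar i = Poly_Mapping.single (Poly_Mapping.single i 1) 1"

definition dvars :: "dpoly \<Rightarrow> nat set" where
  "dvars f = (\<Union>a\<in>Poly_Mapping.keys f. Poly_Mapping.keys a)"

text \<open>Evaluation at \<open>u\<^sub>i = v i\<close>, with the complex coefficients mapped by \<open>\<phi>\<close>
  (in all uses a ring homomorphism).\<close>

definition deval :: "(complex \<Rightarrow> 'b) \<Rightarrow> (nat \<Rightarrow> 'b) \<Rightarrow> dpoly \<Rightarrow> 'b::comm_ring_1" where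
  "deval \<phi> v f =
     (\<Sum>a\<in>Poly_Mapping.keys f. \<phi> (Poly_Mapping.lookup f a) *
        (\<Prod>i\<in>Poly_Mapping.keys a. v i ^ Poly_Mapping.lookup a i))"

definition dpartial :: "nat \<Rightarrow> dpoly \<Rightarrow> dpoly" where
  "dpartial i f =
     (\<Sum>a\<in>Poly_Mapping.keys f.
        Poly_Mapping.single (a - Poly_Mapping.single i 1)
          (of_nat (Poly_Mapping.lookup a i) * Poly_Mapping.lookup f a))"

definition total_deriv :: "dpoly \<Rightarrow> dpoly" where
  "total_deriv f = (\<Sum>i\<in>dvars f. dpartial i f * dvar (Suc i))"


section \<open>Regular chains\<close>

text \<open>\<open>f\<close> as a univariate polynomial in \<open>u\<^sub>i\<close>, whose coefficients do not involve \<open>u\<^sub>i\<close>.\<close>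

definition univ_in :: "nat \<Rightarrow> dpoly \<Rightarrow> dpoly poly" where
  "univ_in i f =
     (\<Sum>a\<in>Poly_Mapping.keys f.
        monom (Poly_Mapping.single (a - Poly_Mapping.single i (Poly_Mapping.lookup a i))
                 (Poly_Mapping.lookup f a))
          (Poly_Mapping.lookup a i))"

text \<open>Only meaningful for non-constant \<open>f\<close>, that is \<open>dvars f \<noteq> {}\<close>.\<close>

definition lead_var :: "dpoly \<Rightarrow> nat" where
  "lead_var f = Max (dvars f)"

definition initial :: "dpoly \<Rightarrow> dpoly" where
  "initial f = lead_coeff (univ_in (lead_var f) f)"

definition res_in :: "nat \<Rightarrow> dpoly \<Rightarrow> dpoly \<Rightarrow> dpoly" where
  "res_in i f g = resultant (univ_in i f) (univ_in i g)"

text \<open>The last polynomial of the list is used first (innermost resultant).\<close>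

definition iterated_res :: "dpoly \<Rightarrow> dpoly list \<Rightarrow> dpoly" where
  "iterated_res f gs = foldr (\<lambda>g h. res_in (lead_var g) h g) gs f"

definition regular_chain :: "dpoly list \<Rightarrow> bool" where
  "regular_chain gs \<longleftrightarrow>
     (\<forall>g\<in>set gs. dvars g \<noteq> {}) \<and>
     sorted_wrt (\<lambda>f g. lead_var f < lead_var g) gs \<and>
     (\<forall>g\<in>set gs. iterated_res (initial g) gs \<noteq> 0)"


section \<open>Reduced differential equation\<close>

text \<open>
  \<open>\<complex>[u\<^sub>0,u\<^sub>1]\<close> is represented by the type \<open>complex poly poly\<close>, with \<open>u\<^sub>1\<close> the outer and
  \<open>u\<^sub>0\<close> the inner variable, and \<open>\<complex>(u\<^sub>0,u\<^sub>1)\<close> by its field of fractions.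
\<close>

definition bi_u0 :: "complex poly poly" where "bi_u0 = [:[:0, 1:]:]"
definition bi_u1 :: "complex poly poly" where "bi_u1 = [:0, 1:]"

text \<open>Only meaningful for \<open>f\<close> with \<open>dvars f \<subseteq> {0, 1}\<close>.\<close>

definition to_bipoly :: "dpoly \<Rightarrow> complex poly poly" where
  "to_bipoly f = deval (\<lambda>c. [:[:c:]:]) (\<lambda>i. if i = 0 then bi_u0 else if i = 1 then bi_u1 else 0) f"

definition from_bipoly :: "complex poly poly \<Rightarrow> dpoly" where
  "from_bipoly H = poly (map_poly (\<lambda>p. poly (map_poly dconst p) (dvar 0)) H) (dvar 1)"

text \<open>\<open>dremainder G1 k\<close> is \<open>R\<^sub>k\<close>, determined by
  \<open>G1\<^bsup>(k)\<^esup> = \<partial>G1/\<partial>u\<^sub>1 * u\<^bsub>k+1\<^esub> + R\<^sub>k\<close>.\<close>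

definition dremainder :: "dpoly \<Rightarrow> nat \<Rightarrow> dpoly" where
  "dremainder G1 k = (total_deriv ^^ k) G1 - dpartial 1 G1 * dvar (Suc k)"

text \<open>
  \<open>bsubst G1 0 = u\<^sub>0\<close>, \<open>bsubst G1 1 = u\<^sub>1\<close> and \<open>bsubst G1 j = B\<^sub>j = A\<^sub>j(u\<^sub>0,u\<^sub>1,B\<^sub>2,\<dots>,B\<^bsub>j-1\<^esub>)\<close>
  for \<open>j \<ge> 2\<close>. The test \<open>i < j\<close> serves termination only: for \<open>G1\<close> in \<open>u\<^sub>0, u\<^sub>1\<close>, the
  polynomial \<open>R\<^bsub>j-1\<^esub>\<close> involves just \<open>u\<^sub>0, \<dots>, u\<^bsub>j-1\<^esub>\<close>.
\<close>

fun bsubst :: "dpoly \<Rightarrow> nat \<Rightarrow> complex poly poly fract" where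
  "bsubst G1 j =
     (if j = 0 then to_fract bi_u0
      else if j = 1 then to_fract bi_u1
      else - deval (\<lambda>c. to_fract [:[:c:]:]) (\<lambda>i. if i < j then bsubst G1 i else 0)
               (dremainder G1 (j - 1))
           / to_fract (to_bipoly (dpartial 1 G1)))"

declare bsubst.simps [simp del]

definition reduced_component :: "(nat \<Rightarrow> dpoly) \<Rightarrow> nat \<Rightarrow> complex poly poly" where
  "reduced_component G j =
     (if j = 1 then to_bipoly (G 1)
      else fst (quot_of_fract (deval (\<lambda>c. to_fract [:[:c:]:]) (bsubst (G 1)) (G j))))"

definition reduced_poly :: "nat \<Rightarrow> (nat \<Rightarrow> dpoly) \<Rightarrow> complex poly poly" where
  "reduced_poly m G = Gcd (reduced_component G ` {1..m})"


section \<open>Formal Puiseux series solutions\<close>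

text \<open>
  A formal Puiseux series is given by its expansion point, a denominator \<open>n > 0\<close>, and a
  Laurent series \<open>y\<close> in \<open>t\<close> whose coefficients are the \<open>c\<^sub>j\<close>; here \<open>t = (x - x0)\<^bsup>1/n\<^esup>\<close> at
  a finite point \<open>x0\<close> and \<open>t = x\<^bsup>-1/n\<^esup>\<close> at infinity. Different triples may denote the
  same series, but being constant or being a solution does not depend on the choice.
\<close>

datatype expansion_point = Finite_point complex | Infinity_point

fun puiseux_deriv :: "expansion_point \<Rightarrow> nat \<Rightarrow> complex fls \<Rightarrow> complex fls" where
  "puiseux_deriv (Finite_point x0) n y =
     fls_const (1 / of_nat n) * fls_shift (int n - 1) (fls_deriv y)"
| "puiseux_deriv Infinity_point n y =
     fls_const (- 1 / of_nat n) * fls_shift (- int n - 1) (fls_deriv y)"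

text \<open>
  Term-by-term derivation: \<open>c (x - x0)\<^bsup>j/n\<^esup>\<close> becomes \<open>(j/n) c (x - x0)\<^bsup>(j-n)/n\<^esup>\<close>, and
  \<open>c x\<^bsup>-j/n\<^esup>\<close> becomes \<open>(-j/n) c x\<^bsup>-(j+n)/n\<^esup>\<close>.
\<close>

lemma puiseux_deriv_nth:
  "fls_nth (puiseux_deriv (Finite_point x0) n y) (j - int n) = of_int j / of_nat n * fls_nth y j"
  "fls_nth (puiseux_deriv Infinity_point n y) (j + int n) = - of_int j / of_nat n * fls_nth y j"
  by simp_all

definition puiseux_solves ::
    "expansion_point \<Rightarrow> nat \<Rightarrow> complex fls \<Rightarrow> dpoly \<Rightarrow> bool" where
  "puiseux_solves P n y f \<longleftrightarrow> deval fls_const (\<lambda>i. (puiseux_deriv P n ^^ i) y) f = 0"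

definition nonconst_puiseux_solutions ::
    "dpoly set \<Rightarrow> (expansion_point \<times> nat \<times> complex fls) set" where
  "nonconst_puiseux_solutions S =
     {(P, n, y). n > 0 \<and> (\<forall>c. y \<noteq> fls_const c) \<and> (\<forall>f\<in>S. puiseux_solves P n y f)}"

end

theory Submission
  imports Defs
begin

text \<open>
  Let \<open>y\<close> be a non-constant Puiseux series and \<open>E\<close> the evaluation of \<open>\<complex>[u\<^sub>0,u\<^sub>1]\<close> at
  \<open>(y,y')\<close>. As \<open>\<complex>\<close> is algebraically closed, \<open>y\<close> is transcendental over it, so \<open>E\<close> is
  injective on \<open>\<complex>[u\<^sub>0]\<close> and its kernel is a principal prime ideal \<open>(p)\<close>, where \<open>p\<close> is zero
  or has positive degree in \<open>u\<^sub>1\<close>. Hence \<open>E\<close> kills a gcd iff it kills all the polynomials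
  involved. If \<open>G\<^sub>1(y,y') = 0\<close>, then the separant \<open>\<partial>G\<^sub>1/\<partial>u\<^sub>1\<close> does not vanish at \<open>(y,y')\<close>,
  since otherwise \<open>p\<^sup>2\<close> would divide \<open>G\<^sub>1\<close>. So the \<open>B\<^sub>j\<close> can be evaluated at \<open>(y,y')\<close>, their
  values are the derivatives of \<open>y\<close>, and \<open>G\<^sub>j\<close> vanishes at \<open>y\<close> iff \<open>H\<^sub>j\<close> does.
\<close>

section \<open>Evaluation of differential polynomials\<close>

lemma comm_ring_hom_compose:
  "comm_ring_hom f \<Longrightarrow> comm_ring_hom g \<Longrightarrow> comm_ring_hom (\<lambda>x. f (g x))"
proof -
  assume "comm_ring_hom f" "comm_ring_hom g"
  then interpret f: comm_ring_hom f + g: comm_ring_hom g .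
  show ?thesis
    by unfold_locales (simp_all add: f.hom_add g.hom_add f.hom_mult g.hom_mult)
qed

lemma comm_ring_hom_poly_map_poly:
  assumes "comm_ring_hom h"
  shows "comm_ring_hom (\<lambda>p. poly (map_poly h p) a)"
proof -
  interpret h: comm_ring_hom h by fact
  interpret map_poly_comm_ring_hom h ..
  show ?thesis
    by unfold_locales (simp_all add: hom_add hom_mult)
qed

definition monom_eval :: "(nat \<Rightarrow> 'b) \<Rightarrow> (nat \<Rightarrow>\<^sub>0 nat) \<Rightarrow> 'b::comm_ring_1" where
  "monom_eval v a = (\<Prod>i\<in>Poly_Mapping.keys a. v i ^ Poly_Mapping.lookup a i)"

lemma deval_monom_eval:
  "deval \<phi> v f = (\<Sum>a\<in>Poly_Mapping.keys f. \<phi> (Poly_Mapping.lookup f a) * monom_eval v a)"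
  by (simp add: deval_def monom_eval_def)

lemma monom_eval_superset:
  assumes "finite A" "Poly_Mapping.keys a \<subseteq> A"
  shows "monom_eval v a = (\<Prod>i\<in>A. v i ^ Poly_Mapping.lookup a i)"
  unfolding monom_eval_def
  using assms by (intro prod.mono_neutral_left) (auto simp: in_keys_iff)

lemma monom_eval_0 [simp]: "monom_eval v 0 = 1"
  by (simp add: monom_eval_def)

lemma monom_eval_add: "monom_eval v (a + b) = monom_eval v a * monom_eval v b"
proof -
  let ?A = "Poly_Mapping.keys a \<union> Poly_Mapping.keys b"
  have "monom_eval v (a + b) = (\<Prod>i\<in>?A. v i ^ Poly_Mapping.lookup (a + b) i)"
    by (rule monom_eval_superset) (simp_all add: Poly_Mapping.keys_add)
  moreover have "monom_eval v a = (\<Prod>i\<in>?A. v i ^ Poly_Mapping.lookup a i)"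
    by (rule monom_eval_superset) auto
  moreover have "monom_eval v b = (\<Prod>i\<in>?A. v i ^ Poly_Mapping.lookup b i)"
    by (rule monom_eval_superset) auto
  ultimately show ?thesis
    by (simp add: lookup_add power_add prod.distrib)
qed

lemma dpoly_induct [case_names zero single add]:
  fixes f :: dpoly
  assumes "P 0" "\<And>a c. P (Poly_Mapping.single a c)" "\<And>f g. P f \<Longrightarrow> P g \<Longrightarrow> P (f + g)"
  shows "P f"
proof (induction f rule: Poly_Mapping.update_induct)
  case (update f a b)
  then have "Poly_Mapping.update a b f = f + Poly_Mapping.single a b"
    by (intro poly_mapping_eqI)
      (auto simp: Poly_Mapping.lookup_update lookup_add lookup_single when_def in_keys_iff)
  with update assms show ?case by simp
qed (rule assms)

context
  fixes \<phi> :: "complex \<Rightarrow> 'b::comm_ring_1" and v :: "nat \<Rightarrow> 'b"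
  assumes hom: "comm_ring_hom \<phi>"
begin

interpretation comm_ring_hom \<phi> by (fact hom)

text \<open>Terms may cancel in \<open>f + g\<close>, so the supports of \<open>f\<close>,
  \<open>g\<close> and \<open>f + g\<close> differ. Summing over one common finite superset makes
  the three evaluations comparable term by term.\<close>

lemma deval_superset:
  assumes "finite A" "Poly_Mapping.keys f \<subseteq> A"
  shows "deval \<phi> v f = (\<Sum>a\<in>A. \<phi> (Poly_Mapping.lookup f a) * monom_eval v a)"
  unfolding deval_monom_eval
  using assms by (intro sum.mono_neutral_left) (auto simp: in_keys_iff)

lemma deval_single: "deval \<phi> v (Poly_Mapping.single a c) = \<phi> c * monom_eval v a"
  by (subst deval_superset[of "{a}"]) auto

lemma deval_add: "deval \<phi> v (f + g) = deval \<phi> v f + deval \<phi> v g"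
proof -
  let ?A = "Poly_Mapping.keys f \<union> Poly_Mapping.keys g"
  have "deval \<phi> v (f + g) = (\<Sum>a\<in>?A. \<phi> (Poly_Mapping.lookup (f + g) a) * monom_eval v a)"
    by (rule deval_superset) (simp_all add: Poly_Mapping.keys_add)
  moreover have "deval \<phi> v f = (\<Sum>a\<in>?A. \<phi> (Poly_Mapping.lookup f a) * monom_eval v a)"
    by (rule deval_superset) auto
  moreover have "deval \<phi> v g = (\<Sum>a\<in>?A. \<phi> (Poly_Mapping.lookup g a) * monom_eval v a)"
    by (rule deval_superset) auto
  ultimately show ?thesis
    by (simp add: lookup_add hom_add algebra_simps sum.distrib)
qed

lemma deval_0: "deval \<phi> v 0 = 0"
  by (simp add: deval_def)

lemma deval_mult: "deval \<phi> v (f * g) = deval \<phi> v f * deval \<phi> v g"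
proof (induction f rule: dpoly_induct)
  case (single a c)
  show ?case
    by (induction g rule: dpoly_induct)
      (simp_all add: deval_0 deval_single deval_add mult_single hom_mult monom_eval_add
        algebra_simps)
qed (simp_all add: deval_0 deval_add algebra_simps)

lemma comm_ring_hom_deval: "comm_ring_hom (deval \<phi> v)"
proof -
  have "deval \<phi> v 1 = 1"
    using deval_single[of 0 1] by simp
  then show ?thesis
    by unfold_locales (simp_all add: deval_0 deval_add deval_mult)
qed

lemma deval_dvar: "deval \<phi> v (dvar i) = v i"
  by (simp add: dvar_def deval_single monom_eval_def)

lemma deval_dconst: "deval \<phi> v (dconst c) = \<phi> c"
  by (simp add: dconst_def deval_single)

end

lemma comm_ring_hom_dconst: "comm_ring_hom dconst"
  by unfold_locales (simp_all add: dconst_def single_add mult_single)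

lemma deval_hom:
  assumes "comm_ring_hom h"
  shows "h (deval \<phi> v f) = deval (\<lambda>c. h (\<phi> c)) (\<lambda>i. h (v i)) f"
proof -
  interpret comm_ring_hom h by fact
  show ?thesis
    by (simp add: deval_def hom_sum hom_mult hom_prod hom_power)
qed

lemma deval_cong:
  "(\<And>c. \<phi> c = \<psi> c) \<Longrightarrow> (\<And>i. i \<in> dvars f \<Longrightarrow> v i = w i) \<Longrightarrow> deval \<phi> v f = deval \<psi> w f"
  unfolding deval_def dvars_def
  by (intro sum.cong prod.cong refl arg_cong2[where f = "(*)"] arg_cong2[where f = "(^)"]) blast+


section \<open>Variables and derivatives\<close>

lemma finite_dvars [simp]: "finite (dvars f)"
  by (simp add: dvars_def)

lemma dvars_0 [simp]: "dvars 0 = {}"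
  by (simp add: dvars_def)

lemma dvars_add: "dvars (f + g) \<subseteq> dvars f \<union> dvars g"
  unfolding dvars_def using Poly_Mapping.keys_add[of f g] by blast

lemma dvars_mult: "dvars (f * g) \<subseteq> dvars f \<union> dvars g"
proof
  fix i assume "i \<in> dvars (f * g)"
  then obtain c where "c \<in> Poly_Mapping.keys (f * g)" "i \<in> Poly_Mapping.keys c"
    by (auto simp: dvars_def)
  then obtain a b where "a \<in> Poly_Mapping.keys f" "b \<in> Poly_Mapping.keys g"
      "i \<in> Poly_Mapping.keys (a + b)"
    using Poly_Mapping.keys_mult[of f g] by blast
  then show "i \<in> dvars f \<union> dvars g"
    using Poly_Mapping.keys_add[of a b] unfolding dvars_def by blast
qed

lemma dvars_1 [simp]: "dvars 1 = {}"
  by (auto simp: dvars_def)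

lemma dvars_single: "dvars (Poly_Mapping.single a c) \<subseteq> Poly_Mapping.keys a"
  by (simp add: dvars_def)

lemma dvars_dvar [simp]: "dvars (dvar i) = {i}"
  by (simp add: dvars_def dvar_def)

lemma dvars_power: "dvars (f ^ n) \<subseteq> dvars f"
proof (induction n)
  case (Suc n)
  then show ?case using dvars_mult[of f "f ^ n"] by auto
qed simp

lemma dvars_sum: "dvars (\<Sum>i\<in>A. f i) \<subseteq> (\<Union>i\<in>A. dvars (f i))"
proof (induction A rule: infinite_finite_induct)
  case (insert x A)
  then show ?case using dvars_add[of "f x" "\<Sum>i\<in>A. f i"] by auto
qed simp_all

lemma dvars_dpartial: "dvars (dpartial i f) \<subseteq> dvars f"
proof -
  have "Poly_Mapping.keys (a - Poly_Mapping.single i 1) \<subseteq> Poly_Mapping.keys a"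
    for a :: "nat \<Rightarrow>\<^sub>0 nat"
    by (auto simp: in_keys_iff lookup_minus)
  then show ?thesis
    unfolding dpartial_def
    by (intro subset_trans[OF dvars_sum] UN_least subset_trans[OF dvars_single])
      (auto simp: dvars_def)
qed

section \<open>Partial derivatives and the total derivative\<close>

lemma dpartial_superset:
  assumes "finite A" "Poly_Mapping.keys f \<subseteq> A"
  shows "dpartial i f = (\<Sum>a\<in>A. Poly_Mapping.single (a - Poly_Mapping.single i 1)
          (of_nat (Poly_Mapping.lookup a i) * Poly_Mapping.lookup f a))"
  unfolding dpartial_def
  using assms by (intro sum.mono_neutral_left) (auto simp: in_keys_iff)

lemma dpartial_single:
  "dpartial i (Poly_Mapping.single a c) =
     Poly_Mapping.single (a - Poly_Mapping.single i 1) (of_nat (Poly_Mapping.lookup a i) * c)"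
  by (subst dpartial_superset[of "{a}"]) auto

lemma dpartial_0 [simp]: "dpartial i 0 = 0"
  by (simp add: dpartial_def)

lemma dpartial_add: "dpartial i (f + g) = dpartial i f + dpartial i g"
proof -
  let ?A = "Poly_Mapping.keys f \<union> Poly_Mapping.keys g"
  let ?S = "\<lambda>f. \<Sum>a\<in>?A. Poly_Mapping.single (a - Poly_Mapping.single i 1)
          (of_nat (Poly_Mapping.lookup a i) * Poly_Mapping.lookup f a)"
  have "dpartial i (f + g) = ?S (f + g)"
    by (rule dpartial_superset) (simp_all add: Poly_Mapping.keys_add)
  moreover have "dpartial i f = ?S f" "dpartial i g = ?S g"
    by (rule dpartial_superset; auto)+
  ultimately show ?thesis
    by (simp add: lookup_add algebra_simps single_add sum.distrib)
qed

lemma dpartial_mult: "dpartial i (f * g) = dpartial i f * g + f * dpartial i g"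
proof (induction f rule: dpoly_induct)
  case (single a c)
  show ?case
  proof (induction g rule: dpoly_induct)
    case (single b d)
    let ?e = "Poly_Mapping.single i (1::nat)"
    \<comment> \<open>Subtraction of exponents is truncated. The two exponents here can differ only
      if \<open>u_i\<close> does not occur in \<open>a\<close>, and then the coefficient is 0 on
      both sides. The same holds for \<open>b\<close> in \<open>right\<close>.\<close>
    have left: "Poly_Mapping.single (a + b - ?e) (of_nat (Poly_Mapping.lookup a i) * (c * d)) =
        Poly_Mapping.single (a - ?e + b) (of_nat (Poly_Mapping.lookup a i) * c * d)"
    proof (cases "Poly_Mapping.lookup a i = 0")
      case False
      then have "a + b - ?e = a - ?e + b"
        by (intro poly_mapping_eqI) (auto simp: lookup_add lookup_minus lookup_single when_def)
      then show ?thesis by (simp add: mult.assoc)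
    qed simp
    have right: "Poly_Mapping.single (a + b - ?e) (of_nat (Poly_Mapping.lookup b i) * (c * d)) =
        Poly_Mapping.single (a + (b - ?e)) (c * (of_nat (Poly_Mapping.lookup b i) * d))"
    proof (cases "Poly_Mapping.lookup b i = 0")
      case False
      then have "a + b - ?e = a + (b - ?e)"
        by (intro poly_mapping_eqI) (auto simp: lookup_add lookup_minus lookup_single when_def)
      then show ?thesis by (simp add: mult_ac)
    qed simp
    show ?case
      unfolding mult_single dpartial_single lookup_add of_nat_add distrib_right single_add
        left right ..
  qed (simp_all add: dpartial_add algebra_simps)
qed (simp_all add: dpartial_add algebra_simps)

lemma dpartial_eq_0: "i \<notin> dvars f \<Longrightarrow> dpartial i f = 0"
  unfolding dpartial_def
  by (intro sum.neutral) (auto simp: dvars_def in_keys_iff)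

lemma total_deriv_superset:
  assumes "finite A" "dvars f \<subseteq> A"
  shows "total_deriv f = (\<Sum>i\<in>A. dpartial i f * dvar (Suc i))"
  unfolding total_deriv_def
  using assms by (intro sum.mono_neutral_left) (auto simp: dpartial_eq_0)

lemma total_deriv_add: "total_deriv (f + g) = total_deriv f + total_deriv g"
proof -
  let ?A = "dvars f \<union> dvars g"
  have "total_deriv (f + g) = (\<Sum>i\<in>?A. dpartial i (f + g) * dvar (Suc i))"
    "total_deriv f = (\<Sum>i\<in>?A. dpartial i f * dvar (Suc i))"
    "total_deriv g = (\<Sum>i\<in>?A. dpartial i g * dvar (Suc i))"
    by (rule total_deriv_superset; use dvars_add in auto)+
  then show ?thesis
    by (simp add: dpartial_add algebra_simps sum.distrib)
qed

lemma total_deriv_mult: "total_deriv (f * g) = total_deriv f * g + f * total_deriv g"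
proof -
  let ?A = "dvars f \<union> dvars g"
  have "total_deriv (f * g) = (\<Sum>i\<in>?A. dpartial i (f * g) * dvar (Suc i))"
    "total_deriv f = (\<Sum>i\<in>?A. dpartial i f * dvar (Suc i))"
    "total_deriv g = (\<Sum>i\<in>?A. dpartial i g * dvar (Suc i))"
    by (rule total_deriv_superset; use dvars_mult in auto)+
  then show ?thesis
    by (simp add: dpartial_mult algebra_simps sum.distrib sum_distrib_left sum_distrib_right)
qed

lemma total_deriv_dvar: "total_deriv (dvar i) = dvar (Suc i)"
  by (simp add: total_deriv_def, simp add: dvar_def dpartial_single)

lemma dvars_total_deriv:
  assumes "dvars f \<subseteq> {..k}"
  shows "dvars (total_deriv f) \<subseteq> {..Suc k}"
proof -
  have "dvars (dpartial i f * dvar (Suc i)) \<subseteq> {..Suc k}" if "i \<in> dvars f" for i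
    using dvars_mult[of "dpartial i f" "dvar (Suc i)"] dvars_dpartial[of i f] assms that by fastforce
  then show ?thesis
    unfolding total_deriv_def by (intro subset_trans[OF dvars_sum] UN_least)
qed

text \<open>With \<open>S\<close> the separant and D the total derivative, differentiating
  \<open>D^k f = S * u_(k+1) + R_k\<close> gives \<open>R_(k+1) = D R_k + D S * u_(k+1)\<close>,
  where \<open>D S\<close> has order at most 2. The count starts at \<open>R_1\<close> because
  \<open>R_0 = f - S * u_1\<close> may still contain \<open>u_1\<close>.\<close>

lemma dvars_dremainder:
  assumes "dvars f \<subseteq> {..1}"
  shows "dvars (dremainder f (Suc k)) \<subseteq> {..Suc k}"
proof (induction k)
  case 0
  have "total_deriv f = (\<Sum>i\<in>{0,1}. dpartial i f * dvar (Suc i))"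
    by (rule total_deriv_superset) (use assms in auto)
  then have "dremainder f (Suc 0) = dpartial 0 f * dvar 1"
    by (simp add: dremainder_def)
  then show ?case
    using dvars_mult[of "dpartial 0 f" "dvar 1"] dvars_dpartial[of 0 f] assms by auto
next
  case (Suc k)
  let ?S = "dpartial 1 f"
  have "(total_deriv ^^ Suc k) f = dremainder f (Suc k) + ?S * dvar (Suc (Suc k))"
    by (simp add: dremainder_def)
  then have "(total_deriv ^^ Suc (Suc k)) f =
      total_deriv (dremainder f (Suc k)) + (total_deriv ?S * dvar (Suc (Suc k)) +
      ?S * dvar (Suc (Suc (Suc k))))"
    by (simp add: total_deriv_add total_deriv_mult total_deriv_dvar)
  then have "dremainder f (Suc (Suc k)) =
      total_deriv (dremainder f (Suc k)) + total_deriv ?S * dvar (Suc (Suc k))"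
    by (simp add: dremainder_def)
  moreover have "dvars (total_deriv ?S) \<subseteq> {..Suc 1}"
    by (rule dvars_total_deriv) (use dvars_dpartial[of 1 f] assms in auto)
  ultimately show ?case
    using dvars_total_deriv[OF Suc] dvars_add[of "total_deriv (dremainder f (Suc k))"
        "total_deriv ?S * dvar (Suc (Suc k))"] dvars_mult[of "total_deriv ?S" "dvar (Suc (Suc k))"]
    by (fastforce simp del: funpow.simps)
qed

section \<open>Abstract derivations and the chain rule, for use with both d/du_1 on C[u_0,u_1] and
  d/dx on Puiseux series\<close>

definition derivation :: "('b::comm_ring_1 \<Rightarrow> 'b) \<Rightarrow> bool" where
  "derivation \<delta> \<longleftrightarrow> (\<forall>a b. \<delta> (a + b) = \<delta> a + \<delta> b) \<and> (\<forall>a b. \<delta> (a * b) = \<delta> a * b + a * \<delta> b)"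

context
  fixes \<delta> :: "'b::comm_ring_1 \<Rightarrow> 'b"
  assumes der: "derivation \<delta>"
begin

lemma derivation_add: "\<delta> (a + b) = \<delta> a + \<delta> b"
  using der by (simp add: derivation_def)

lemma derivation_mult: "\<delta> (a * b) = \<delta> a * b + a * \<delta> b"
  using der by (simp add: derivation_def)

lemma derivation_0: "\<delta> 0 = 0"
  using derivation_add[of 0 0] by simp

lemma derivation_1: "\<delta> 1 = 0"
  using derivation_mult[of 1 1] by simp

lemma derivation_sum: "\<delta> (\<Sum>i\<in>A. f i) = (\<Sum>i\<in>A. \<delta> (f i))"
  by (induction A rule: infinite_finite_induct) (simp_all add: derivation_0 derivation_add)

lemma derivation_power: "\<delta> (x ^ n) = of_nat n * x ^ (n - 1) * \<delta> x"
proof (induction n)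
  case (Suc n)
  then show ?case
    by (cases n) (simp_all add: derivation_mult algebra_simps)
qed (simp add: derivation_1)

lemma derivation_prod:
  assumes "finite A"
  shows "\<delta> (\<Prod>i\<in>A. f i) = (\<Sum>i\<in>A. \<delta> (f i) * (\<Prod>j\<in>A - {i}. f j))"
  using assms
proof (induction A)
  case (insert x A)
  have "(\<Prod>j\<in>insert x A - {i}. f j) = f x * (\<Prod>j\<in>A - {i}. f j)" if "i \<in> A" for i
  proof -
    have "insert x A - {i} = insert x (A - {i})" using that insert by auto
    then show ?thesis using insert by simp
  qed
  moreover have "insert x A - {x} = A" using insert by auto
  ultimately show ?case
    using insert by (simp add: derivation_mult sum_distrib_left mult_ac)
qed (simp add: derivation_1)

lemma derivation_monom_eval:
  assumes "finite A" "Poly_Mapping.keys a \<subseteq> A"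
  shows "\<delta> (monom_eval v a) = (\<Sum>i\<in>A. of_nat (Poly_Mapping.lookup a i) *
           monom_eval v (a - Poly_Mapping.single i 1) * \<delta> (v i))"
proof -
  have eq: "monom_eval v (a - Poly_Mapping.single i 1) =
      v i ^ (Poly_Mapping.lookup a i - 1) * (\<Prod>j\<in>A - {i}. v j ^ Poly_Mapping.lookup a j)"
    if "i \<in> A" for i
  proof -
    have "monom_eval v (a - Poly_Mapping.single i 1) =
        (\<Prod>j\<in>A. v j ^ Poly_Mapping.lookup (a - Poly_Mapping.single i 1) j)"
      by (rule monom_eval_superset) (use assms in \<open>auto simp: in_keys_iff lookup_minus\<close>)
    also have "\<dots> = v i ^ (Poly_Mapping.lookup a i - 1) *
        (\<Prod>j\<in>A - {i}. v j ^ Poly_Mapping.lookup (a - Poly_Mapping.single i 1) j)"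
      using assms that by (simp add: prod.remove[of A i] lookup_minus)
    also have "(\<Prod>j\<in>A - {i}. v j ^ Poly_Mapping.lookup (a - Poly_Mapping.single i 1) j) =
        (\<Prod>j\<in>A - {i}. v j ^ Poly_Mapping.lookup a j)"
      by (intro prod.cong) (auto simp: lookup_minus lookup_single)
    finally show ?thesis .
  qed
  have "\<delta> (monom_eval v a) = (\<Sum>i\<in>A. \<delta> (v i ^ Poly_Mapping.lookup a i) *
      (\<Prod>j\<in>A - {i}. v j ^ Poly_Mapping.lookup a j))"
    unfolding monom_eval_superset[OF assms] by (rule derivation_prod) fact
  also have "\<dots> = (\<Sum>i\<in>A. of_nat (Poly_Mapping.lookup a i) *
           monom_eval v (a - Poly_Mapping.single i 1) * \<delta> (v i))"
    by (intro sum.cong refl) (simp add: eq derivation_power mult_ac del: One_nat_def)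
  finally show ?thesis .
qed

text \<open>The chain rule: the Leibniz rule settles each monomial, and exchanging the two sums
  collects the partial derivatives. Allowing any finite \<open>A\<close> containing the variables
  lets {0, 1} serve even when \<open>f\<close> omits one of them.\<close>

lemma derivation_deval:
  assumes "comm_ring_hom \<phi>" "\<And>c. \<delta> (\<phi> c) = 0" "finite A" "dvars f \<subseteq> A"
  shows "\<delta> (deval \<phi> v f) = (\<Sum>i\<in>A. deval \<phi> v (dpartial i f) * \<delta> (v i))"
proof -
  interpret \<phi>: comm_ring_hom \<phi> by fact
  interpret ev: comm_ring_hom "deval \<phi> v" by (rule comm_ring_hom_deval) fact
  have "\<delta> (deval \<phi> v f) = (\<Sum>a\<in>Poly_Mapping.keys f. \<phi> (Poly_Mapping.lookup f a) * \<delta> (monom_eval v a))"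
    unfolding deval_monom_eval derivation_sum by (simp add: derivation_mult assms(2))
  also have "\<dots> = (\<Sum>a\<in>Poly_Mapping.keys f. \<Sum>i\<in>A. \<phi> (Poly_Mapping.lookup f a) *
      (of_nat (Poly_Mapping.lookup a i) * monom_eval v (a - Poly_Mapping.single i 1) * \<delta> (v i)))"
  proof (intro sum.cong refl)
    fix a assume "a \<in> Poly_Mapping.keys f"
    then have "Poly_Mapping.keys a \<subseteq> A" using assms by (auto simp: dvars_def)
    then show "\<phi> (Poly_Mapping.lookup f a) * \<delta> (monom_eval v a) = (\<Sum>i\<in>A. \<phi> (Poly_Mapping.lookup f a) *
      (of_nat (Poly_Mapping.lookup a i) * monom_eval v (a - Poly_Mapping.single i 1) * \<delta> (v i)))"
      by (simp add: derivation_monom_eval[OF assms(3)] sum_distrib_left)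
  qed
  also have "\<dots> = (\<Sum>i\<in>A. \<Sum>a\<in>Poly_Mapping.keys f. \<phi> (Poly_Mapping.lookup f a) *
      (of_nat (Poly_Mapping.lookup a i) * monom_eval v (a - Poly_Mapping.single i 1) * \<delta> (v i)))"
    by (rule sum.swap)
  also have "\<dots> = (\<Sum>i\<in>A. deval \<phi> v (dpartial i f) * \<delta> (v i))"
    by (simp add: dpartial_def ev.hom_sum deval_single[OF assms(1)] \<phi>.hom_mult \<phi>.hom_of_nat
        sum_distrib_left sum_distrib_right mult_ac)
  finally show ?thesis .
qed

text \<open>By the chain rule, evaluation at the jet of \<open>y\<close> turns the total derivative
  into \<open>\<delta>\<close>: the factor \<open>\<delta> (v i)\<close> is the value of
  \<open>u_(i+1)\<close>.\<close>

lemma deval_total_deriv_funpow: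
  assumes "comm_ring_hom \<phi>" "\<And>c. \<delta> (\<phi> c) = 0"
  shows "deval \<phi> (\<lambda>i. (\<delta> ^^ i) y) ((total_deriv ^^ k) f) =
         (\<delta> ^^ k) (deval \<phi> (\<lambda>i. (\<delta> ^^ i) y) f)"
proof (induction k)
  case (Suc k)
  let ?v = "\<lambda>i. (\<delta> ^^ i) y"
  interpret ev: comm_ring_hom "deval \<phi> ?v" by (rule comm_ring_hom_deval) fact
  have "deval \<phi> ?v (total_deriv g) = \<delta> (deval \<phi> ?v g)" for g
    by (simp add: total_deriv_def derivation_deval[OF assms finite_dvars order_refl]
        ev.hom_sum ev.hom_mult deval_dvar[OF assms(1)])
  with Suc show ?case by simp
qed simp

end

lemma derivation_pderiv: "derivation (pderiv :: 'a::idom poly \<Rightarrow> 'a poly)"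
  by (simp add: derivation_def pderiv_add pderiv_mult algebra_simps)

text \<open>A shift is multiplication by a power of t, so the operator is d/dt times the fixed
  factor dt/dx, namely t^(1-n)/n at a finite point and -t^(n+1)/n at infinity.\<close>

lemma derivation_puiseux_deriv: "derivation (puiseux_deriv P n)"
  by (cases P) (simp_all add: derivation_def fls_shifted_times_simps algebra_simps)

lemma puiseux_deriv_const: "puiseux_deriv P n (fls_const c) = 0"
  by (cases P) simp_all

lemma comm_ring_hom_fls_const: "comm_ring_hom (fls_const :: complex \<Rightarrow> complex fls)"
  by unfold_locales (simp_all add: fls_plus_const)


section \<open>Kernels of evaluations of bivariate polynomials\<close>

text \<open>A nonzero kernel element of least degree, made primitive, divides every kernel element:
  pseudo-division by it leaves the remainder 0, and Gauss' lemma removes the scalar factor.\<close>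

lemma hom_kernel_principal:
  fixes E :: "'a::{factorial_ring_gcd,semiring_gcd_mult_normalize} poly \<Rightarrow> 'b::idom"
  assumes "comm_ring_hom E" and inj: "\<And>c. E [:c:] = 0 \<Longrightarrow> c = 0"
  obtains p where "\<And>f. E f = 0 \<longleftrightarrow> p dvd f"
proof (cases "\<exists>f. f \<noteq> 0 \<and> E f = 0")
  case False
  interpret comm_ring_hom E by fact
  from False have "E f = 0 \<longleftrightarrow> 0 dvd f" for f by auto
  then show ?thesis by (rule that)
next
  case True
  interpret comm_ring_hom E by fact
  obtain h where h: "h \<noteq> 0" "E h = 0" and min: "\<And>f. f \<noteq> 0 \<Longrightarrow> E f = 0 \<Longrightarrow> degree h \<le> degree f"
    using True ex_has_least_nat[of "\<lambda>f. f \<noteq> 0 \<and> E f = 0" _ degree] by metis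
  define p where "p = primitive_part h"
  have h_eq: "h = [:content h:] * p" by (simp add: p_def)
  \<comment> \<open>The content can be divided out without leaving the kernel: its image is nonzero
    and the target is a domain.\<close>
  have "E [:content h:] \<noteq> 0" using inj[of "content h"] h by auto
  moreover have "E h = E [:content h:] * E p"
    using arg_cong[OF h_eq, of E] by (simp only: hom_mult)
  ultimately have Ep: "E p = 0" using h by simp
  have p: "p \<noteq> 0" "degree p = degree h" "content p = 1" using h by (simp_all add: p_def)
  have "p dvd f" if "E f = 0" for f
  proof -
    obtain a q where a: "a \<noteq> 0" "Polynomial.smult a f = p * q + pseudo_mod f p"
      and deg: "pseudo_mod f p = 0 \<or> degree (pseudo_mod f p) < degree p"
      using pseudo_mod[OF p(1), of f] by blast
    have "pseudo_mod f p = [:a:] * f - p * q" using a by simp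
    then have "E (pseudo_mod f p) = 0"
      using that Ep by (simp only: hom_minus hom_mult) simp
    with deg min p have "pseudo_mod f p = 0" by (metis not_le)
    with a have eq: "[:a:] * f = p * q" by simp
    then have "content ([:a:] * f) = content (p * q)" by simp
    then have "normalize a * content f = content q"
      using p by (simp add: content_mult)
    then have "[:a:] dvd q"
      by (metis const_poly_dvd_iff_dvd_content dvd_triv_left normalize_dvd_iff dvd_trans)
    then obtain q' where "q = [:a:] * q'" by (elim dvdE)
    with eq have "[:a:] * f = [:a:] * (p * q')" by (simp add: mult_ac)
    with a have "f = p * q'" by (simp only: mult_cancel_left) simp
    then show ?thesis by simp
  qed
  moreover have "E f = 0" if "p dvd f" for f
    using that Ep by (auto elim!: dvdE simp: hom_mult)
  ultimately show ?thesis using that[of p] by blast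
qed

text \<open>Write \<open>f = p * h\<close> with \<open>p\<close> generating the kernel. Then
  \<open>E\<close> maps the derivative of \<open>f\<close> to \<open>E (pderiv p) * E h\<close>. In
  characteristic 0 the derivative of \<open>p\<close> is nonzero of smaller degree, hence outside
  the kernel; so if the product vanished, \<open>p\<close> would divide \<open>h\<close> and
  \<open>p^2\<close> would divide \<open>f\<close>.\<close>

lemma squarefree_hom_pderiv_nonzero:
  fixes E :: "'a::{factorial_ring_gcd,semiring_gcd_mult_normalize,semiring_char_0} poly \<Rightarrow> 'b::idom"
  assumes "comm_ring_hom E" and inj: "\<And>c. E [:c:] = 0 \<Longrightarrow> c = 0"
    and "squarefree f" "E f = 0"
  shows "E (pderiv f) \<noteq> 0"
proof
  interpret comm_ring_hom E by fact
  assume S: "E (pderiv f) = 0"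
  obtain p where p: "\<And>f. E f = 0 \<longleftrightarrow> p dvd f"
    using hom_kernel_principal[OF assms(1) inj] by blast
  obtain h where h: "f = p * h" using assms p by (auto elim: dvdE)
  have "f \<noteq> 0" using assms(3) by auto
  with h have "p \<noteq> 0" by auto
  have "E p = 0" using p by simp
  have "degree p \<noteq> 0"
  proof
    assume "degree p = 0"
    then obtain c where "p = [:c:]" by (rule degree_eq_zeroE)
    with inj \<open>E p = 0\<close> \<open>p \<noteq> 0\<close> show False by auto
  qed
  then have "pderiv p \<noteq> 0" by (simp add: pderiv_eq_0_iff)
  have "degree (pderiv p) < degree p" using \<open>degree p \<noteq> 0\<close> by (simp add: degree_pderiv)
  with \<open>pderiv p \<noteq> 0\<close> have "\<not> p dvd pderiv p" by (meson dvd_imp_degree_le not_le)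
  then have "E (pderiv p) \<noteq> 0" using p by simp
  moreover have "E (pderiv p) * E h = 0"
    using S \<open>E p = 0\<close> by (simp add: h pderiv_mult hom_add hom_mult mult_ac)
  ultimately have "p dvd h" using p by simp
  then have "p ^ 2 dvd f" by (auto simp: h power2_eq_square)
  then have "is_unit p" using assms(3) by (simp add: squarefree_def)
  \<comment> \<open>Being a unit means dividing 1, which by the choice of \<open>p\<close> would put
    1 into the kernel.\<close>
  then have "E 1 = 0" unfolding p .
  then show False by simp
qed


section \<open>Specialization of rational functions\<close>

text \<open>\<open>specializes E x z\<close> extends \<open>E\<close> to the localization at its kernel; when \<open>E\<close> is not
  injective this is only a relation, partial in \<open>x\<close>.\<close>

definition specializes :: "('a::idom \<Rightarrow> 'b::field) \<Rightarrow> 'a fract \<Rightarrow> 'b \<Rightarrow> bool" where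
  "specializes E x z \<longleftrightarrow> (\<exists>a b. E b \<noteq> 0 \<and> x = to_fract a / to_fract b \<and> z = E a / E b)"

context
  fixes E :: "'a::idom \<Rightarrow> 'b::field"
  assumes hom: "comm_ring_hom E"
begin

interpretation comm_ring_hom E by (fact hom)

lemma specializesE:
  assumes "specializes E x z"
  obtains a b where "b \<noteq> 0" "E b \<noteq> 0" "x = to_fract a / to_fract b" "z = E a / E b"
proof -
  from assms obtain a b where "E b \<noteq> 0" "x = to_fract a / to_fract b" "z = E a / E b"
    unfolding specializes_def by blast
  moreover from \<open>E b \<noteq> 0\<close> have "b \<noteq> 0" by (metis hom_zero)
  ultimately show ?thesis by (rule that[rotated])
qed

lemma specializes_to_fract: "specializes E (to_fract a) (E a)"
  unfolding specializes_def by (rule exI[of _ a], rule exI[of _ 1]) simp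

lemma specializes_0: "specializes E 0 0"
  using specializes_to_fract[of 0] by simp

lemma specializes_1: "specializes E 1 1"
  using specializes_to_fract[of 1] by simp

lemma specializes_add:
  assumes "specializes E x z" "specializes E x' z'"
  shows "specializes E (x + x') (z + z')"
proof -
  obtain a b where ab: "b \<noteq> 0" "E b \<noteq> 0" "x = to_fract a / to_fract b" "z = E a / E b"
    using assms(1) by (rule specializesE)
  obtain a' b' where ab': "b' \<noteq> 0" "E b' \<noteq> 0" "x' = to_fract a' / to_fract b'" "z' = E a' / E b'"
    using assms(2) by (rule specializesE)
  show ?thesis
    unfolding specializes_def
    by (rule exI[of _ "a * b' + a' * b"], rule exI[of _ "b * b'"])
      (use ab ab' in \<open>simp add: hom_add hom_mult add_frac_eq\<close>)
qed

lemma specializes_mult: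
  assumes "specializes E x z" "specializes E x' z'"
  shows "specializes E (x * x') (z * z')"
proof -
  obtain a b where ab: "E b \<noteq> 0" "x = to_fract a / to_fract b" "z = E a / E b"
    using assms(1) by (rule specializesE)
  obtain a' b' where ab': "E b' \<noteq> 0" "x' = to_fract a' / to_fract b'" "z' = E a' / E b'"
    using assms(2) by (rule specializesE)
  show ?thesis
    unfolding specializes_def
    by (rule exI[of _ "a * a'"], rule exI[of _ "b * b'"]) (use ab ab' in \<open>simp add: hom_mult\<close>)
qed

lemma specializes_uminus:
  assumes "specializes E x z"
  shows "specializes E (- x) (- z)"
proof -
  have "specializes E (to_fract (- 1) * x) (E (- 1) * z)"
    by (rule specializes_mult[OF specializes_to_fract assms])
  then show ?thesis by (simp add: hom_uminus)
qed

text \<open>This is the division step in the recursion for the \<open>B_j\<close>, with the separant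
  as \<open>s\<close>.\<close>

lemma specializes_divide_to_fract:
  assumes "specializes E x z" "E s \<noteq> 0"
  shows "specializes E (x / to_fract s) (z / E s)"
proof -
  have "specializes E (1 / to_fract s) (1 / E s)"
    unfolding specializes_def by (rule exI[of _ 1], rule exI[of _ s]) (use assms in simp)
  from specializes_mult[OF assms(1) this] show ?thesis by simp
qed

lemma specializes_sum:
  "(\<And>i. i \<in> A \<Longrightarrow> specializes E (f i) (g i)) \<Longrightarrow> specializes E (\<Sum>i\<in>A. f i) (\<Sum>i\<in>A. g i)"
proof (induction A rule: infinite_finite_induct)
  case (insert i A)
  have "specializes E (f i + sum f A) (g i + sum g A)"
    by (intro specializes_add insert) auto
  with insert show ?case by simp
qed (simp_all add: specializes_0)

lemma specializes_prod:
  "(\<And>i. i \<in> A \<Longrightarrow> specializes E (f i) (g i)) \<Longrightarrow> specializes E (\<Prod>i\<in>A. f i) (\<Prod>i\<in>A. g i)"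
proof (induction A rule: infinite_finite_induct)
  case (insert i A)
  have "specializes E (f i * prod f A) (g i * prod g A)"
    by (intro specializes_mult insert) auto
  with insert show ?case by simp
qed (simp_all add: specializes_1)

lemma specializes_power: "specializes E x z \<Longrightarrow> specializes E (x ^ n) (z ^ n)"
  by (induction n) (simp_all add: specializes_1 specializes_mult)

lemma specializes_deval:
  assumes "\<And>c. specializes E (\<phi> c) (\<psi> c)" "\<And>i. i \<in> dvars f \<Longrightarrow> specializes E (w i) (v i)"
  shows "specializes E (deval \<phi> w f) (deval \<psi> v f)"
  unfolding deval_def
  by (rule specializes_sum, rule specializes_mult, rule assms, rule specializes_prod,
      rule specializes_power, rule assms) (auto simp: dvars_def)

end

text \<open>The fraction \<open>a / b\<close> witnessing the specialization need not be in lowest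
  terms. The reduced denominator \<open>q\<close> divides \<open>b\<close>, so \<open>E q\<close> is
  nonzero too, and \<open>p * b = a * q\<close> shows that the numerators \<open>p\<close> and
  \<open>a\<close> vanish together. This justifies taking \<open>H_j\<close> to be the reduced
  numerator.\<close>

lemma specializes_eq_0_iff:
  fixes E :: "'a::{factorial_ring_gcd,semiring_gcd_mult_normalize} \<Rightarrow> 'b::field"
  assumes "comm_ring_hom E" "specializes E x z"
  shows "z = 0 \<longleftrightarrow> E (fst (quot_of_fract x)) = 0"
proof -
  interpret comm_ring_hom E by fact
  obtain a b where ab: "b \<noteq> 0" "E b \<noteq> 0" "x = to_fract a / to_fract b" "z = E a / E b"
    using assms by (rule specializesE)
  define p q where "p = fst (quot_of_fract x)" and "q = snd (quot_of_fract x)"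
  have "Fract p q = x" by (simp add: p_def q_def)
  also have "x = Fract a b" using ab by (simp add: Fract_conv_to_fract)
  finally have "Fract p q = Fract a b" .
  have "q \<noteq> 0" by (simp add: q_def)
  with \<open>Fract p q = Fract a b\<close> have eq: "p * b = a * q" using ab by (simp add: eq_fract)
  have "coprime p q" unfolding p_def q_def by (rule coprime_quot_of_fract)
  moreover have "q dvd p * b" by (simp add: eq)
  ultimately have "q dvd b" by (simp add: coprime_dvd_mult_right_iff coprime_commute)
  then have "E q \<noteq> 0" using ab by (auto elim!: dvdE simp: hom_mult)
  moreover have "E p * E b = E a * E q" using eq by (metis hom_mult)
  ultimately have "E a = 0 \<longleftrightarrow> E p = 0" using ab by (metis mult_eq_0_iff)
  then show ?thesis using ab by (simp add: p_def)
qed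


section \<open>Non-constant Puiseux series\<close>

text \<open>Over C a linear factor \<open>u - z\<close> splits off from any non-constant polynomial,
  and \<open>y - z\<close> is nonzero for a non-constant series. Induction on the degree does the
  rest, as Laurent series form a field.\<close>

lemma nonconst_fls_transcendental:
  fixes y :: "complex fls"
  assumes "\<And>c. y \<noteq> fls_const c" "p \<noteq> 0"
  shows "poly (map_poly fls_const p) y \<noteq> 0"
  using assms(2)
proof (induction "degree p" arbitrary: p)
  case 0
  then obtain c where "p = [:c:]" by (metis degree_eq_zeroE)
  with 0 show ?case by (simp add: Polynomial.map_poly_pCons)
next
  case (Suc n)
  interpret h: comm_ring_hom "\<lambda>p. poly (map_poly fls_const p) y"
    by (rule comm_ring_hom_poly_map_poly[OF comm_ring_hom_fls_const])
  have "\<not> constant (poly p)" using Suc by (simp add: constant_degree)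
  then obtain z where "poly p z = 0" using fundamental_theorem_of_algebra by blast
  then obtain q where q: "p = [:-z, 1:] * q" by (auto simp: poly_eq_0_iff_dvd)
  with Suc have "q \<noteq> 0" by auto
  then have "degree p = Suc (degree q)"
    unfolding q by (subst degree_mult_eq) auto
  with Suc \<open>q \<noteq> 0\<close> have "poly (map_poly fls_const q) y \<noteq> 0"
    by (intro Suc.hyps(1)) auto
  moreover have "poly (map_poly fls_const [:-z, 1:]) y = y - fls_const z"
    by (simp add: Polynomial.map_poly_pCons)
  ultimately show ?case
    unfolding q h.hom_mult using assms(1) by simp
qed

section \<open>Evaluation of C[u_0,u_1] at (y,y')\<close>

lemma comm_ring_hom_from_bipoly: "comm_ring_hom from_bipoly"
  unfolding from_bipoly_def
  by (intro comm_ring_hom_poly_map_poly comm_ring_hom_dconst)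

text \<open>The chain rule for d/du_1, which sends \<open>bi_u0\<close> to 0 and
  \<open>bi_u1\<close> to 1, leaves only the summand with index 1.\<close>

lemma pderiv_to_bipoly:
  assumes "dvars f \<subseteq> {..1}"
  shows "pderiv (to_bipoly f) = to_bipoly (dpartial 1 f)"
proof -
  have hom: "comm_ring_hom (\<lambda>c. [:[:c:]:] :: complex poly poly)"
    by unfold_locales (simp_all add: one_pCons)
  have "dvars f \<subseteq> {0, 1}" using assms by auto
  then show ?thesis
    unfolding to_bipoly_def
    by (subst derivation_deval[OF derivation_pderiv hom, of "{0, 1}"])
      (simp_all add: bi_u0_def bi_u1_def pderiv_pCons)
qed

context
  fixes P :: expansion_point and n :: nat and y :: "complex fls"
  assumes nonconst: "\<And>c. y \<noteq> fls_const c"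
begin

abbreviation "jet i \<equiv> (puiseux_deriv P n ^^ i) y"

abbreviation "jet_eval f \<equiv> deval fls_const (\<lambda>i. jet i) f"

text \<open>Going through \<open>from_bipoly\<close> makes this exactly the evaluation by which
  \<open>puiseux_solves\<close> tests the reduced equation.\<close>

abbreviation "bi_eval H \<equiv> jet_eval (from_bipoly H)"

lemma comm_ring_hom_jet_eval: "comm_ring_hom (\<lambda>f. jet_eval f)"
  by (rule comm_ring_hom_deval[OF comm_ring_hom_fls_const])

lemma comm_ring_hom_bi_eval: "comm_ring_hom (\<lambda>H. bi_eval H)"
  by (rule comm_ring_hom_compose[OF comm_ring_hom_jet_eval comm_ring_hom_from_bipoly])

lemma bi_eval_const: "bi_eval [:c:] = poly (map_poly fls_const c) y"
proof -
  interpret ev: comm_ring_hom "\<lambda>f. jet_eval f" by (rule comm_ring_hom_jet_eval)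
  have "jet_eval (poly (map_poly dconst c) (dvar 0)) = poly (map_poly fls_const c) y"
    by (induction c)
      (simp_all add: Polynomial.map_poly_pCons dconst_def[of 0] ev.hom_add ev.hom_mult
        deval_dvar[OF comm_ring_hom_fls_const] deval_dconst[OF comm_ring_hom_fls_const])
  then show ?thesis by (simp add: from_bipoly_def Polynomial.map_poly_pCons)
qed

lemma bi_eval_const_eq_0: "bi_eval [:c:] = 0 \<Longrightarrow> c = 0"
  using nonconst_fls_transcendental[OF nonconst] by (auto simp: bi_eval_const)

lemma bi_eval_bi_u0: "bi_eval bi_u0 = jet 0"
  by (simp add: bi_u0_def bi_eval_const Polynomial.map_poly_pCons)

lemma bi_eval_bi_u1: "bi_eval bi_u1 = jet 1"
proof -
  have "from_bipoly bi_u1 = dvar 1"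
    by (simp add: from_bipoly_def bi_u1_def Polynomial.map_poly_pCons dconst_def one_pCons)
  then show ?thesis by (simp only: deval_dvar[OF comm_ring_hom_fls_const])
qed

lemma bi_eval_to_bipoly:
  assumes "dvars f \<subseteq> {..1}"
  shows "bi_eval (to_bipoly f) = jet_eval f"
  unfolding to_bipoly_def deval_hom[OF comm_ring_hom_bi_eval]
proof (rule deval_cong)
  fix i assume "i \<in> dvars f"
  with assms have "i = 0 \<or> i = 1" by force
  then show "bi_eval (if i = 0 then bi_u0 else if i = 1 then bi_u1 else 0) = jet i"
    using bi_eval_bi_u0 bi_eval_bi_u1 by auto
qed (simp add: bi_eval_const Polynomial.map_poly_pCons)

section \<open>Series that solve the first equation, here called \<open>f\<close>\<close>

context
  fixes f :: dpoly
  assumes vars: "dvars f \<subseteq> {..1}" and sqf: "squarefree (to_bipoly f)" and zero: "jet_eval f = 0"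
begin

lemma separant_nonzero: "bi_eval (to_bipoly (dpartial 1 f)) \<noteq> 0"
  using squarefree_hom_pderiv_nonzero[OF comm_ring_hom_bi_eval bi_eval_const_eq_0 sqf]
  by (simp add: zero bi_eval_to_bipoly[OF vars] pderiv_to_bipoly[OF vars])

text \<open>Differentiating \<open>f(y,y') = 0\<close> exactly k + 1 times gives
  \<open>S * y^(k+2) + R_(k+1) = 0\<close> at the jet, and the nonvanishing separant
  \<open>S\<close> can be divided out.\<close>

lemma jet_recursion:
  "jet (Suc (Suc k)) =
     - jet_eval (dremainder f (Suc k)) / bi_eval (to_bipoly (dpartial 1 f))"
proof -
  interpret ev: comm_ring_hom "\<lambda>f. jet_eval f" by (rule comm_ring_hom_jet_eval)
  have "(puiseux_deriv P n ^^ k) 0 = 0" for k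
    by (induction k) (simp_all add: derivation_0[OF derivation_puiseux_deriv])
  then have "jet_eval ((total_deriv ^^ Suc k) f) = 0"
    by (simp only: deval_total_deriv_funpow[OF derivation_puiseux_deriv comm_ring_hom_fls_const
          puiseux_deriv_const] zero)
  moreover have "(total_deriv ^^ Suc k) f =
      dremainder f (Suc k) + dpartial 1 f * dvar (Suc (Suc k))"
    by (simp add: dremainder_def)
  ultimately have "jet_eval (dremainder f (Suc k)) +
      jet_eval (dpartial 1 f) * jet (Suc (Suc k)) = 0"
    by (simp only: ev.hom_add ev.hom_mult deval_dvar[OF comm_ring_hom_fls_const])
  then have "jet (Suc (Suc k)) * jet_eval (dpartial 1 f) = - jet_eval (dremainder f (Suc k))"
    by (simp only: eq_neg_iff_add_eq_0 mult.commute add.commute)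
  moreover have "bi_eval (to_bipoly (dpartial 1 f)) = jet_eval (dpartial 1 f)"
    by (rule bi_eval_to_bipoly) (use dvars_dpartial[of 1 f] vars in auto)
  ultimately show ?thesis
    using separant_nonzero by (simp only: eq_divide_eq) simp
qed

text \<open>The \<open>B_j\<close> and the derivatives of \<open>y\<close> start from matching
  values and obey the same recursion, so strong induction on \<open>j\<close> applies.\<close>

lemma specializes_bsubst: "specializes (\<lambda>H. bi_eval H) (bsubst f j) (jet j)"
proof (induction j rule: less_induct)
  case (less j)
  note to_fract = specializes_to_fract[OF comm_ring_hom_bi_eval]
  consider "j = 0" | "j = 1" | k where "j = Suc (Suc k)"
    by (metis One_nat_def not0_implies_Suc)
  then show ?case
  proof cases
    case 1
    then show ?thesis
      using to_fract[of bi_u0] bi_eval_bi_u0 by (simp add: bsubst.simps)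
  next
    case 2
    then show ?thesis
      using to_fract[of bi_u1] bi_eval_bi_u1 by (simp add: bsubst.simps)
  next
    case (3 k)
    let ?R = "dremainder f (Suc k)"
    let ?w = "\<lambda>i. if i < j then bsubst f i else 0"
    have "specializes (\<lambda>H. bi_eval H) (deval (\<lambda>c. to_fract [:[:c:]:]) ?w ?R) (jet_eval ?R)"
    proof (rule specializes_deval[OF comm_ring_hom_bi_eval])
      fix c show "specializes (\<lambda>H. bi_eval H) (to_fract [:[:c:]:]) (fls_const c)"
        using to_fract[of "[:[:c:]:]"] by (simp add: bi_eval_const Polynomial.map_poly_pCons)
    next
      fix i assume "i \<in> dvars ?R"
      \<comment> \<open>All variables of the remainder have index below \<open>j\<close>, so the
        default value 0 in \<open>?w\<close> is never read.\<close>
      then have "i < j" using dvars_dremainder[OF vars, of k] 3 by auto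
      then show "specializes (\<lambda>H. bi_eval H) (?w i) (jet i)" using less by simp
    qed
    from specializes_divide_to_fract[OF comm_ring_hom_bi_eval
        specializes_uminus[OF comm_ring_hom_bi_eval this] separant_nonzero]
    have "specializes (\<lambda>H. bi_eval H)
        (- deval (\<lambda>c. to_fract [:[:c:]:]) ?w ?R / to_fract (to_bipoly (dpartial 1 f))) (jet j)"
      unfolding 3 jet_recursion .
    moreover have "bsubst f j =
        - deval (\<lambda>c. to_fract [:[:c:]:]) ?w ?R / to_fract (to_bipoly (dpartial 1 f))"
      by (subst bsubst.simps) (simp add: 3)
    ultimately show ?thesis by simp
  qed
qed

lemma jet_eval_eq_0_iff:
  "jet_eval g = 0 \<longleftrightarrow>
     bi_eval (fst (quot_of_fract (deval (\<lambda>c. to_fract [:[:c:]:]) (bsubst f) g))) = 0"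
proof (rule specializes_eq_0_iff[OF comm_ring_hom_bi_eval],
    rule specializes_deval[OF comm_ring_hom_bi_eval])
  fix c show "specializes (\<lambda>H. bi_eval H) (to_fract [:[:c:]:]) (fls_const c)"
    using specializes_to_fract[OF comm_ring_hom_bi_eval, of "[:[:c:]:]"]
    by (simp add: bi_eval_const Polynomial.map_poly_pCons)
qed (rule specializes_bsubst)

end

text \<open>A common zero of several polynomials need not be a zero of their gcd in two variables.
  It is one here because the kernel is principal: its generator divides the gcd iff it divides every
  component.\<close>

lemma bi_eval_reduced_poly_eq_0_iff:
  "bi_eval (reduced_poly m G) = 0 \<longleftrightarrow> (\<forall>j\<in>{1..m}. bi_eval (reduced_component G j) = 0)"
proof -
  obtain p where "\<And>f. bi_eval f = 0 \<longleftrightarrow> p dvd f"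
    using hom_kernel_principal[OF comm_ring_hom_bi_eval bi_eval_const_eq_0] by blast
  then show ?thesis by (simp add: reduced_poly_def dvd_Gcd_iff)
qed

text \<open>If \<open>y\<close> solves the first equation, the components \<open>H_j\<close> and the
  equations \<open>G j\<close> vanish together. Otherwise both sides fail, because
  \<open>H_1\<close> is \<open>G 1\<close> itself and the index 1 lies in the range.\<close>

lemma puiseux_solves_reduced_iff:
  assumes "m \<ge> 1" "dvars (G 1) \<subseteq> {..1}" "squarefree (to_bipoly (G 1))"
  shows "puiseux_solves P n y (from_bipoly (reduced_poly m G)) \<longleftrightarrow>
    (\<forall>j\<in>{1..m}. puiseux_solves P n y (G j))"
proof (cases "jet_eval (G 1) = 0")
  case True
  have "bi_eval (reduced_component G j) = 0 \<longleftrightarrow> jet_eval (G j) = 0" for j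
    by (cases "j = 1") (simp_all add: reduced_component_def bi_eval_to_bipoly[OF assms(2)]
        jet_eval_eq_0_iff[OF assms(2,3) True, symmetric] del: One_nat_def)
  then show ?thesis
    by (simp add: puiseux_solves_def bi_eval_reduced_poly_eq_0_iff)
next
  case False
  then have "bi_eval (reduced_component G 1) \<noteq> 0"
    by (simp add: reduced_component_def bi_eval_to_bipoly[OF assms(2)] del: One_nat_def)
  with False assms(1) show ?thesis
    unfolding puiseux_solves_def bi_eval_reduced_poly_eq_0_iff by fastforce
qed

end

theorem theorem3p2:
  fixes m :: nat and r :: "nat \<Rightarrow> nat" and C :: "nat \<Rightarrow> nat \<Rightarrow> dpoly" and G :: "nat \<Rightarrow> dpoly"
  assumes "m \<ge> 1"
    and "\<And>i. i \<in> {1..m} \<Longrightarrow> G i = (\<Sum>j\<le>r i. C i j * dvar i ^ j)"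
    and "\<And>i j. i \<in> {1..m} \<Longrightarrow> j \<le> r i \<Longrightarrow> dvars (C i j) \<subseteq> {..<i}"
    and "\<And>i. i \<in> {1..m} \<Longrightarrow> r i \<ge> 1 \<and> C i (r i) \<noteq> 0"
    and "regular_chain (map G [1..<Suc m])"
    and "squarefree (to_bipoly (G 1))"
    and "\<And>p :: complex poly. [:p:] dvd to_bipoly (G 1) \<Longrightarrow> degree p = 0"
    and "\<And>q :: complex poly. map_poly (\<lambda>c. [:c:]) q dvd to_bipoly (G 1) \<Longrightarrow> degree q = 0"
  shows "nonconst_puiseux_solutions (G ` {1..m}) =
         nonconst_puiseux_solutions {from_bipoly (reduced_poly m G)}"
proof -
  \<comment> \<open>The coefficients \<open>C 1 j\<close> involve only \<open>u_0\<close>, so the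
    first equation has order at most 1, as the separant argument requires.\<close>
  have "dvars (G 1) \<subseteq> {..1}"
  proof -
    have "dvars (C 1 j * dvar 1 ^ j) \<subseteq> {..1}" if "j \<le> r 1" for j
      using dvars_mult[of "C 1 j" "dvar 1 ^ j"] dvars_power[of "dvar 1" j] assms(3)[of 1 j] that
        assms(1) by fastforce
    then show ?thesis
      using assms(1) by (subst assms(2)) (auto dest!: subsetD[OF dvars_sum])
  qed
  then have "puiseux_solves P n y (from_bipoly (reduced_poly m G)) \<longleftrightarrow>
      (\<forall>j\<in>{1..m}. puiseux_solves P n y (G j))" if "\<And>c. y \<noteq> fls_const c" for P n y
    using puiseux_solves_reduced_iff that assms(1,6) by blast
  then show ?thesis
    unfolding nonconst_puiseux_solutions_def by fastforce
qed

end
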